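(* Let $\mathcal{L}$ be a finite meet-semilattice and $\mathcal{G}$ a building set of $\mathcal{L}$, with a chosen linear order $\mathcal{G}=\{G_1,\dots,G_t\}$ such that $G_i>G_j$ (in $\mathcal{L}$) implies $i<j$. For $1\le k\le t$ let $\mathrm{Bl}_k\mathcal{L}=\mathrm{Bl}_{G_k}(\mathrm{Bl}_{G_{k-1}}(\dots \mathrm{Bl}_{G_1}\mathcal{L}))$ denote the result of successive combinatorial blowups at $G_1,\dots,G_k$. Then the final semilattice $\mathrm{Bl}_t\mathcal{L}$ is equal (i.e. isomorphic as a poset) to the face poset of the simplicial complex $\mathcal{N}(\mathcal{G})$ of nested sets of $\mathcal{G}$, where the face poset includes the empty face as minimal element.
   Context: All posets are finite. A meet-semilattice is a poset in which any two elements have a greatest lower bound (meet); its minimal element is denoted $\hat 0$. In a (finite) meet-semilattice any subset $A$ that has an upper bound has a least upper bound, the join $\bigvee A$. For a subset $\mathcal{G}$ of $\mathcal{L}$ and $x\in\mathcal{L}$ put $\mathcal{G}_{\le x}=\{y\in\mathcal{G}\mid y\le x\}$. Building set: a subset $\mathcal{G}\subseteq\mathcal{L}\setminus\{\hat 0\}$ is a building set of $\mathcal{L}$ if for any $x\in\mathcal{L}\setminus\{\hat 0\}$, with $\max\mathcal{G}_{\le x}=\{x_1,\dots,x_k\}$ (the set of maximal elements of $\mathcal{G}_{\le x}$), there is an isomorphism of posets $\varphi_x:\prod_{j=1}^k[\hat 0,x_j]\to[\hat 0,x]$ with $\varphi_x(\hat 0,\dots,x_j,\dots,\hat 0)=x_j$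 for $j=1,\dots,k$. Nested set: a subset $N\subseteq\mathcal{G}$ is nested if for any set of pairwise incomparable elements $x_1,\dots,x_t\in N$ of cardinality at least two, the join $x_1\vee\dots\vee x_t$ exists in $\mathcal{L}$ and does not belong to $\mathcal{G}$. The nested subsets of $\mathcal{G}$ form an abstract simplicial complex $\mathcal{N}(\mathcal{G})$ with vertex set $\mathcal{G}$. Combinatorial blowup: for a meet-semilattice $\mathcal{L}$ and $\alpha\in\mathcal{L}$, the poset $\mathrm{Bl}_\alpha\mathcal{L}$ has as elements (1) the $y\in\mathcal{L}$ with $y\not\ge\alpha$, and (2) formal symbols $[\alpha,y]$ for $y\in\mathcal{L}$ such that $y\not\ge\alpha$ and the join $y\vee\alpha$ exists in $\mathcal{L}$. Its (strict) order relations are, for $y,z\not\ge\alpha$: $y>z$ if $y>z$ in $\mathcal{L}$; $[\alpha,y]>[\alpha,z]$ if $y>z$ in $\mathcal{L}$; $[\alpha,y]>z$ if $y\ge z$ in $\mathcal{L}$. In the iterated blowup, each $G_k$ is regarded as an element of type (1) of $\mathrm{Bl}_{k-1}\mathcal{L}$, which is possible since $G_k\not\ge G_j$ for $j<k$. *)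

theory Defs
  imports "HOL-Algebra.Lattice" "HOL-Library.FuncSet"
begin

definition poset_iso :: "'a gorder \<Rightarrow> 'b gorder \<Rightarrow> ('a \<Rightarrow> 'b) \<Rightarrow> bool" where
  "poset_iso P Q f \<longleftrightarrow> bij_betw f (carrier P) (carrier Q) \<and> order_emb P Q f"

definition interval_poset :: "'a gorder \<Rightarrow> 'a \<Rightarrow> 'a \<Rightarrow> 'a gorder" where
  "interval_poset L a b = L\<lparr>carrier := \<lbrace>a..b\<rbrace>\<^bsub>L\<^esub>\<rparr>"

definition product_poset :: "'i set \<Rightarrow> ('i \<Rightarrow> 'a gorder) \<Rightarrow> ('i \<Rightarrow> 'a) gorder" where
  "product_poset I P =
    \<lparr>carrier = (\<Pi>\<^sub>E i\<in>I. carrier (P i)),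
     eq = (=),
     le = (\<lambda>u v. \<forall>i\<in>I. u i \<sqsubseteq>\<^bsub>P i\<^esub> v i)\<rparr>"

definition max_below :: "'a gorder \<Rightarrow> 'a set \<Rightarrow> 'a \<Rightarrow> 'a set" where
  "max_below L \<G> x =
    {y \<in> \<G>. y \<sqsubseteq>\<^bsub>L\<^esub> x \<and> \<not> (\<exists>z\<in>\<G>. z \<sqsubseteq>\<^bsub>L\<^esub> x \<and> y \<sqsubset>\<^bsub>L\<^esub> z)}"

text \<open>The product of the intervals is indexed by the set of maximal elements itself, so the
  tuple with \<open>m\<close> in its own position and the bottom element elsewhere is the extensional
  function below.\<close>

definition building_set :: "'a gorder \<Rightarrow> 'a set \<Rightarrow> bool" where
  "building_set L \<G> \<longleftrightarrow>
    \<G> \<subseteq> carrier L - {\<bottom>\<^bsub>L\<^esub>} \<and>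
    (\<forall>x \<in> carrier L - {\<bottom>\<^bsub>L\<^esub>}. \<exists>\<phi>.
      poset_iso
        (product_poset (max_below L \<G> x) (\<lambda>m. interval_poset L \<bottom>\<^bsub>L\<^esub> m))
        (interval_poset L \<bottom>\<^bsub>L\<^esub> x) \<phi> \<and>
      (\<forall>m \<in> max_below L \<G> x.
        \<phi> (\<lambda>j \<in> max_below L \<G> x. if j = m then m else \<bottom>\<^bsub>L\<^esub>) = m))"

definition nested :: "'a gorder \<Rightarrow> 'a set \<Rightarrow> 'a set \<Rightarrow> bool" where
  "nested L \<G> N \<longleftrightarrow>
    N \<subseteq> \<G> \<and>
    (\<forall>A \<subseteq> N. 2 \<le> card A \<and> (\<forall>x\<in>A. \<forall>y\<in>A. x \<noteq> y \<longrightarrow> \<not> x \<sqsubseteq>\<^bsub>L\<^esub> y) \<longrightarrow>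
      (\<exists>s. is_lub L s A \<and> s \<notin> \<G>))"

definition nested_complex :: "'a gorder \<Rightarrow> 'a set \<Rightarrow> 'a set set" where
  "nested_complex L \<G> = {N. nested L \<G> N}"

text \<open>A simplicial complex is given by its set of faces, including the empty face.\<close>

definition face_poset :: "'a set set \<Rightarrow> 'a set gorder" where
  "face_poset K = \<lparr>carrier = K, eq = (=), le = (\<subseteq>)\<rparr>"

text \<open>All iterated blowups of a poset on \<open>'a\<close> live in the type \<open>'a blowup_elem\<close>.
  A single blowup at \<open>\<alpha>\<close> retags the elements \<open>y\<close> that are kept as \<open>Old y\<close> and writes the
  formal symbol \<open>[\<alpha>, y]\<close> as \<open>New \<alpha> y\<close>; the tags keep the two kinds apart
  for every poset that is blown up.  \<open>Elem\<close> embeds the poset one starts with.\<close>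

datatype 'a blowup_elem =
    Elem 'a
  | Old "'a blowup_elem"
  | New "'a blowup_elem" "'a blowup_elem"

inductive blowup_less ::
  "'a blowup_elem gorder \<Rightarrow> 'a blowup_elem \<Rightarrow> 'a blowup_elem \<Rightarrow> 'a blowup_elem \<Rightarrow> bool"
  for L \<alpha> where
  old_old: "z \<sqsubset>\<^bsub>L\<^esub> y \<Longrightarrow> blowup_less L \<alpha> (Old z) (Old y)"
| new_new: "z \<sqsubset>\<^bsub>L\<^esub> y \<Longrightarrow> blowup_less L \<alpha> (New \<alpha> z) (New \<alpha> y)"
| old_new: "z \<sqsubseteq>\<^bsub>L\<^esub> y \<Longrightarrow> blowup_less L \<alpha> (Old z) (New \<alpha> y)"

definition blowup :: "'a blowup_elem gorder \<Rightarrow> 'a blowup_elem \<Rightarrow> 'a blowup_elem gorder" where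
  "blowup L \<alpha> =
    \<lparr>carrier =
       {Old y | y. y \<in> carrier L \<and> \<not> \<alpha> \<sqsubseteq>\<^bsub>L\<^esub> y} \<union>
       {New \<alpha> y | y. y \<in> carrier L \<and> \<not> \<alpha> \<sqsubseteq>\<^bsub>L\<^esub> y \<and> (\<exists>s. is_lub L s {y, \<alpha>})},
     eq = (=),
     le = (\<lambda>u v. u = v \<or> blowup_less L \<alpha> u v)\<rparr>"

definition elem_poset :: "'a gorder \<Rightarrow> 'a blowup_elem gorder" where
  "elem_poset L =
    \<lparr>carrier = Elem ` carrier L,
     eq = (=),
     le = (\<lambda>u v. \<exists>x y. u = Elem x \<and> v = Elem y \<and> x \<sqsubseteq>\<^bsub>L\<^esub> y)\<rparr>"

text \<open>After \<open>k\<close> blowups an element \<open>x\<close> of the original poset that has been kept throughout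
  is \<open>(Old ^^ k) (Elem x)\<close>.\<close>

primrec iterated_blowup :: "'a gorder \<Rightarrow> (nat \<Rightarrow> 'a) \<Rightarrow> nat \<Rightarrow> 'a blowup_elem gorder" where
  "iterated_blowup L G 0 = elem_poset L"
| "iterated_blowup L G (Suc k) =
    blowup (iterated_blowup L G k) ((Old ^^ k) (Elem (G (Suc k))))"

end

theory Submission
  imports Defs
begin

text \<open>Tagging each element of \<open>Bl\<^sub>k L\<close> with the indices \<open>i\<close> at which it became a new symbol
  \<open>[G\<^sub>i, _]\<close>, and remembering the underlying \<open>y \<in> L\<close>, turns \<open>Bl\<^sub>k L\<close> into a set of pairs
  \<open>(I, y)\<close> ordered componentwise. By induction on \<open>k\<close>, the pairs that occur are those with
  \<open>I \<subseteq> {1..k}\<close>, with no \<open>G\<^sub>1, \<dots>, G\<^sub>k\<close> below \<open>y\<close>, and such that \<open>{G\<^sub>i | i \<in> I}\<close> together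
  with the maximal elements of \<open>\<G>\<close> below \<open>y\<close> is nested: the join with \<open>G\<^sub>k\<close> exists in
  \<open>Bl\<^bsub>k-1\<^esub> L\<close> exactly if adding \<open>G\<^sub>k\<close> to that set keeps it nested. For \<open>k = t\<close> only
  \<open>y = \<bottom>\<close> is left.\<close>

section \<open>Finite meet-semilattices\<close>

text \<open>Among the elements of \<open>A\<close> above \<open>a\<close>, one with the most
  elements of \<open>A\<close> below it is maximal: a strictly larger element would raise this count
  by at least itself.\<close>

lemma (in partial_order) finite_maximal_above:
  assumes "finite A" "A \<subseteq> carrier L" "a \<in> A"
  obtains m where "m \<in> A" "a \<sqsubseteq> m" "\<And>z. z \<in> A \<Longrightarrow> m \<sqsubseteq> z \<Longrightarrow> z = m"
proof -
  let ?B = "{h \<in> A. a \<sqsubseteq> h}" and ?f = "\<lambda>h. card {z \<in> A. z \<sqsubseteq> h}"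
  have "a \<sqsubseteq> a" using assms by auto
  then have B: "finite ?B" "?B \<noteq> {}" using assms by auto
  then have "Max (?f ` ?B) \<in> ?f ` ?B" by (intro Max_in) auto
  then obtain m where m: "m \<in> ?B" "?f m = Max (?f ` ?B)" by auto
  have "z = m" if z: "z \<in> A" "m \<sqsubseteq> z" for z
  proof (rule ccontr)
    assume "z \<noteq> m"
    have c: "a \<in> carrier L" "m \<in> carrier L" "z \<in> carrier L" using assms m z by auto
    have "z \<in> ?B" using z m c le_trans[of a m z] by auto
    then have "?f z \<le> ?f m" unfolding m(2) using B by (intro Max_ge) auto
    moreover have "{u \<in> A. u \<sqsubseteq> m} \<subset> {u \<in> A. u \<sqsubseteq> z}"
    proof -
      have "z \<notin> {u \<in> A. u \<sqsubseteq> m}" using \<open>z \<noteq> m\<close> c z le_antisym by blast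
      moreover have "z \<in> {u \<in> A. u \<sqsubseteq> z}" using z c by auto
      moreover have "{u \<in> A. u \<sqsubseteq> m} \<subseteq> {u \<in> A. u \<sqsubseteq> z}"
        using z(2) c assms(2) le_trans[of _ m z] by auto
      ultimately show ?thesis by blast
    qed
    then have "?f m < ?f z" using assms(1) by (intro psubset_card_mono) auto
    ultimately show False by simp
  qed
  then show thesis using that m by auto
qed

lemma is_lub_iff:
  "A \<subseteq> carrier L \<Longrightarrow> is_lub L s A \<longleftrightarrow>
    s \<in> carrier L \<and> (\<forall>a\<in>A. a \<sqsubseteq>\<^bsub>L\<^esub> s) \<and> (\<forall>u\<in>carrier L. (\<forall>a\<in>A. a \<sqsubseteq>\<^bsub>L\<^esub> u) \<longrightarrow> s \<sqsubseteq>\<^bsub>L\<^esub> u)"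
  unfolding least_def Upper_def by blast

locale building_semilattice = lower_semilattice L for L :: "'a gorder" (structure) +
  fixes \<G> :: "'a set"
  assumes finite_carrier: "finite (carrier L)"
    and carrier_nonempty: "carrier L \<noteq> {}"
    and building: "building_set L \<G>"
begin

text \<open>The bottom is the meet of the whole carrier, which exists because the carrier is finite
  and nonempty.\<close>

sublocale weak_partial_order_bottom L
proof
  have "greatest L (\<Sqinter>carrier L) (Lower L (carrier L))"
    by (rule finite_inf_greatest) (auto simp: finite_carrier carrier_nonempty)
  then show "\<exists>x. least L x (carrier L)"
    unfolding greatest_def least_def Lower_def by blast
qed

section \<open>Joins of bounded sets, and the factors of an element\<close>

abbreviation factors :: "'a \<Rightarrow> 'a set" where
  "factors \<equiv> max_below L \<G>"

lemma building_subset: "\<G> \<subseteq> carrier L" and bottom_notin_building: "\<bottom> \<notin> \<G>"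
  using building unfolding building_set_def by auto

lemma finite_building: "finite \<G>"
  using building_subset finite_carrier finite_subset by blast

text \<open>The join is the meet of all upper bounds of \<open>A\<close>; they form a finite set
  that contains \<open>u\<close>.\<close>

lemma lub_exists:
  assumes "A \<subseteq> carrier L" "u \<in> carrier L" "\<And>a. a \<in> A \<Longrightarrow> a \<sqsubseteq> u"
  obtains s where "is_lub L s A" "s \<sqsubseteq> u"
proof -
  let ?U = "Upper L A"
  have u: "u \<in> ?U" using assms by (auto simp: Upper_def)
  have U: "?U \<subseteq> carrier L" "?U \<noteq> {}" using u by (auto simp: Upper_def)
  have inf: "greatest L (\<Sqinter>?U) (Lower L ?U)"
    by (rule finite_inf_greatest[OF finite_subset[OF U(1) finite_carrier] U])
  have below: "\<Sqinter>?U \<sqsubseteq> v" if "v \<in> ?U" for v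
    using greatest_Lower_below[OF inf that U(1)] .
  have "a \<sqsubseteq> \<Sqinter>?U" if "a \<in> A" for a
  proof -
    have "a \<in> Lower L ?U" using that assms(1) unfolding Lower_def Upper_def by blast
    then show ?thesis using inf unfolding greatest_def by blast
  qed
  then have "is_lub L (\<Sqinter>?U) A"
    using greatest_closed[OF inf] below assms(1) unfolding is_lub_iff[OF assms(1)]
    by (simp add: Upper_def subset_iff)
  then show thesis using that below[OF u] by blast
qed

lemma mem_factors:
  "m \<in> factors x \<longleftrightarrow> m \<in> \<G> \<and> m \<sqsubseteq> x \<and> (\<forall>z\<in>\<G>. z \<sqsubseteq> x \<longrightarrow> m \<sqsubseteq> z \<longrightarrow> z = m)"
  unfolding max_below_def lless_def eq_is_equal by auto

lemma factors_subset: "factors x \<subseteq> \<G>"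
  by (auto simp: mem_factors)

lemma factor_le: "m \<in> factors x \<Longrightarrow> m \<sqsubseteq> x"
  by (simp add: mem_factors)

lemma factor_maximal: "m \<in> factors x \<Longrightarrow> z \<in> \<G> \<Longrightarrow> z \<sqsubseteq> x \<Longrightarrow> m \<sqsubseteq> z \<Longrightarrow> z = m"
  unfolding mem_factors by blast

lemma factor_closed: "m \<in> factors x \<Longrightarrow> m \<in> carrier L"
  using factors_subset building_subset by blast

lemma factor_above:
  assumes "h \<in> \<G>" "h \<sqsubseteq> x"
  obtains m where "m \<in> factors x" "h \<sqsubseteq> m"
proof -
  have "finite {z \<in> \<G>. z \<sqsubseteq> x}" "{z \<in> \<G>. z \<sqsubseteq> x} \<subseteq> carrier L"
    using finite_building building_subset by auto
  then obtain m where m: "m \<in> {z \<in> \<G>. z \<sqsubseteq> x}" "h \<sqsubseteq> m"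
    "\<And>z. z \<in> {z \<in> \<G>. z \<sqsubseteq> x} \<Longrightarrow> m \<sqsubseteq> z \<Longrightarrow> z = m"
    using finite_maximal_above[of "{z \<in> \<G>. z \<sqsubseteq> x}" h] assms by blast
  then have "m \<in> factors x" by (simp add: mem_factors)
  then show thesis using that m(2) by blast
qed

lemma factors_bottom: "factors \<bottom> = {}"
proof -
  have "m = \<bottom>" if "m \<in> \<G>" "m \<sqsubseteq> \<bottom>" for m
    using that building_subset by (intro le_antisym) auto
  then show ?thesis using bottom_notin_building unfolding max_below_def by blast
qed

section \<open>Building sets\<close>

lemma factorization:
  assumes "x \<in> carrier L" "x \<noteq> \<bottom>"
  obtains \<phi> where
    "bij_betw \<phi> (\<Pi>\<^sub>E m\<in>factors x. \<lbrace>\<bottom>..m\<rbrace>) \<lbrace>\<bottom>..x\<rbrace>"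
    "\<And>u v. u \<in> (\<Pi>\<^sub>E m\<in>factors x. \<lbrace>\<bottom>..m\<rbrace>) \<Longrightarrow> v \<in> (\<Pi>\<^sub>E m\<in>factors x. \<lbrace>\<bottom>..m\<rbrace>) \<Longrightarrow>
       \<phi> u \<sqsubseteq> \<phi> v \<longleftrightarrow> (\<forall>m\<in>factors x. u m \<sqsubseteq> v m)"
    "\<And>m. m \<in> factors x \<Longrightarrow> \<phi> (\<lambda>j\<in>factors x. if j = m then m else \<bottom>) = m"
proof -
  from building assms obtain \<phi> where
    "poset_iso (product_poset (factors x) (\<lambda>m. interval_poset L \<bottom> m)) (interval_poset L \<bottom> x) \<phi>"
    "\<forall>m \<in> factors x. \<phi> (\<lambda>j \<in> factors x. if j = m then m else \<bottom>) = m"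
    unfolding building_set_def by blast
  then show thesis
    by (intro that[of \<phi>])
       (auto simp: poset_iso_def order_emb_def product_poset_def interval_poset_def)
qed

text \<open>Here \<open>u\<close> is the value of \<open>\<phi>\<close> at the tuple with \<open>\<phi>\<inverse> y\<close> in position \<open>m\<close> and the full factors elsewhere.\<close>

lemma replace_factor:
  assumes x: "x \<in> carrier L" "x \<noteq> \<bottom>" and m: "m \<in> factors x"
    and y: "y \<in> carrier L" "y \<sqsubseteq> m"
  obtains u where "u \<in> carrier L" "u \<sqsubseteq> x" "y \<sqsubseteq> u" "m \<sqsubseteq> u \<Longrightarrow> y = m"
    "\<And>m'. m' \<in> factors x \<Longrightarrow> m' \<noteq> m \<Longrightarrow> m' \<sqsubseteq> u"
proof -
  let ?P = "\<Pi>\<^sub>E m\<in>factors x. \<lbrace>\<bottom>..m\<rbrace>"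
  let ?e = "\<lambda>m. \<lambda>j\<in>factors x. if j = m then m else \<bottom>"
  obtain \<phi> where bij: "bij_betw \<phi> ?P \<lbrace>\<bottom>..x\<rbrace>"
    and le: "\<And>u v. u \<in> ?P \<Longrightarrow> v \<in> ?P \<Longrightarrow> \<phi> u \<sqsubseteq> \<phi> v \<longleftrightarrow> (\<forall>m\<in>factors x. u m \<sqsubseteq> v m)"
    and e: "\<And>m. m \<in> factors x \<Longrightarrow> \<phi> (?e m) = m"
    using factorization[OF x] by blast
  have eP: "?e j \<in> ?P" for j using factor_closed by (auto simp: at_least_at_most_def)
  have "m \<sqsubseteq> x" using m by (simp add: mem_factors)
  then have "y \<in> \<lbrace>\<bottom>..x\<rbrace>"
    using y x factor_closed[OF m] le_trans[of y m x] by (auto simp: at_least_at_most_def)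
  then obtain v where v: "v \<in> ?P" "\<phi> v = y" using bij by (metis bij_betw_imp_surj_on imageE)
  have vc: "v j \<in> carrier L" "v j \<sqsubseteq> j" if "j \<in> factors x" for j
    using v(1) that by (auto simp: at_least_at_most_def PiE_iff)
  have v_le: "\<forall>j\<in>factors x. v j \<sqsubseteq> ?e m j"
    using le[OF v(1) eP, of m] y v e[OF m] by simp
  define w where "w = (\<lambda>j\<in>factors x. if j = m then v m else j)"
  have wP: "w \<in> ?P" using vc m factor_closed by (auto simp: w_def at_least_at_most_def)
  then have w: "\<phi> w \<in> \<lbrace>\<bottom>..x\<rbrace>" using bij by (metis bij_betw_apply)
  show thesis
  proof
    show "\<phi> w \<in> carrier L" "\<phi> w \<sqsubseteq> x" using w by (auto simp: at_least_at_most_def)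
    show "y \<sqsubseteq> \<phi> w"
      using le[OF v(1) wP] v(2) vc factor_closed by (auto simp: w_def)
    show "m' \<sqsubseteq> \<phi> w" if "m' \<in> factors x" "m' \<noteq> m" for m'
      using le[OF eP wP, of m'] e[OF that(1)] that factor_closed vc m by (auto simp: w_def)
    show "y = m" if "m \<sqsubseteq> \<phi> w"
    proof -
      \<comment> \<open>The tuple of \<open>m\<close> is bottom outside position \<open>m\<close>,
        so this single inequality puts it below \<open>v\<close>, the preimage of \<open>y\<close>;
        hence \<open>m\<close> lies below \<open>y\<close>.\<close>
      have "m \<sqsubseteq> v m" using le[OF eP wP, of m] e[OF m] that m by (auto simp: w_def)
      then have "\<phi> (?e m) \<sqsubseteq> \<phi> v" using le[OF eP v(1)] vc m factor_closed by auto
      then show ?thesis using e[OF m] v(2) y factor_closed[OF m] le_antisym by auto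
    qed
  qed
qed

text \<open>Let \<open>w\<close> be the preimage under \<open>\<phi>\<close> of the join
  \<open>s\<close> of the factors. Since \<open>s\<close> is above each factor \<open>m\<close>,
  \<open>w\<close> is above \<open>m\<close> in position \<open>m\<close>, hence above the preimage
  \<open>v\<close> of \<open>x\<close>, and so \<open>x\<close> is below \<open>s\<close>.\<close>

lemma lub_factors:
  assumes x: "x \<in> carrier L"
  shows "is_lub L x (factors x)"
proof (cases "x = \<bottom>")
  case True
  then show ?thesis using is_lub_iff[of "{}" L] factors_bottom by auto
next
  case False
  let ?P = "\<Pi>\<^sub>E m\<in>factors x. \<lbrace>\<bottom>..m\<rbrace>"
  let ?e = "\<lambda>m. \<lambda>j\<in>factors x. if j = m then m else \<bottom>"
  obtain \<phi> where bij: "bij_betw \<phi> ?P \<lbrace>\<bottom>..x\<rbrace>"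
    and le: "\<And>u v. u \<in> ?P \<Longrightarrow> v \<in> ?P \<Longrightarrow> \<phi> u \<sqsubseteq> \<phi> v \<longleftrightarrow> (\<forall>m\<in>factors x. u m \<sqsubseteq> v m)"
    and e: "\<And>m. m \<in> factors x \<Longrightarrow> \<phi> (?e m) = m"
    using factorization[OF x False] by blast
  have sub: "factors x \<subseteq> carrier L" using factors_subset building_subset by blast
  have eP: "?e j \<in> ?P" for j using factor_closed by (auto simp: at_least_at_most_def)
  obtain v where v: "v \<in> ?P" "\<phi> v = x"
    using bij x by (metis (no_types, lifting) at_least_at_most_def bij_betw_imp_surj_on bottom_lower
        imageE le_refl mem_Collect_eq)
  have "x \<sqsubseteq> u" if u: "u \<in> carrier L" "\<forall>m\<in>factors x. m \<sqsubseteq> u" for u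
  proof -
    have "m \<sqsubseteq> x" if "m \<in> factors x" for m using that by (simp add: mem_factors)
    then obtain s where s: "is_lub L s (factors x)" "s \<sqsubseteq> x" using lub_exists[OF sub x] by blast
    note s' = s(1)[unfolded is_lub_iff[OF sub]]
    have "s \<in> \<lbrace>\<bottom>..x\<rbrace>" using s s' by (auto simp: at_least_at_most_def)
    then obtain w where w: "w \<in> ?P" "\<phi> w = s" using bij by (metis bij_betw_imp_surj_on imageE)
    have "v m \<sqsubseteq> w m" if m: "m \<in> factors x" for m
    proof -
      have "m \<sqsubseteq> w m" using le[OF eP w(1), of m] e[OF m] w s' m by auto
      moreover have "v m \<in> carrier L" "v m \<sqsubseteq> m" "w m \<in> carrier L"
        using v(1) w(1) m by (auto simp: at_least_at_most_def PiE_iff)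
      ultimately show ?thesis using le_trans[of "v m" m "w m"] m sub by auto
    qed
    then have "x \<sqsubseteq> s" using le[OF v(1) w(1)] v w by simp
    then show ?thesis using le_trans[of x s u] s' u x by auto
  qed
  then show ?thesis using x unfolding is_lub_iff[OF sub] by (auto simp: mem_factors)
qed

text \<open>By \<open>lub_factors\<close>, such an \<open>x\<close> is an empty join. This forces
  the base element to be the bottom once all of \<G> has been blown up.\<close>

lemma factors_eq_empty:
  assumes x: "x \<in> carrier L" and "factors x = {}"
  shows "x = \<bottom>"
proof -
  have "x \<sqsubseteq> \<bottom>"
    using lub_factors[OF x] assms(2) is_lub_iff[of "{}" L x] by simp
  then show ?thesis using x by (intro le_antisym) auto
qed

section \<open>Nested sets\<close>

lemma nested_mono: "nested L \<G> N \<Longrightarrow> M \<subseteq> N \<Longrightarrow> nested L \<G> M"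
  unfolding nested_def by blast

lemma card_ge_2_not_le:
  assumes "2 \<le> card A"
  shows "\<not> A \<subseteq> {a}"
  using card_mono[of "{a}" A] assms by auto

text \<open>If the join of an antichain of factors were in \<G>, it would lie between each of them
  and \<open>x\<close>; by maximality each would equal it, leaving a single element.\<close>

lemma nested_factors:
  assumes x: "x \<in> carrier L"
  shows "nested L \<G> (factors x)"
  unfolding nested_def
proof (intro conjI allI impI factors_subset)
  fix A assume A: "A \<subseteq> factors x" and *: "2 \<le> card A \<and> (\<forall>x\<in>A. \<forall>y\<in>A. x \<noteq> y \<longrightarrow> \<not> x \<sqsubseteq> y)"
  have Ac: "A \<subseteq> carrier L" using A factors_subset building_subset by blast
  have "a \<sqsubseteq> x" if "a \<in> A" for a using that A factor_le by blast
  then obtain s where s: "is_lub L s A" "s \<sqsubseteq> x" using lub_exists[OF Ac x] by blast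
  have "s \<notin> \<G>"
  proof
    assume sG: "s \<in> \<G>"
    have "a = s" if "a \<in> A" for a
    proof -
      have "a \<sqsubseteq> s" using s(1) that unfolding is_lub_iff[OF Ac] by blast
      then show ?thesis using factor_maximal[of a x] that A s(2) sG by blast
    qed
    then show False using card_ge_2_not_le[of A s] * by blast
  qed
  then show "\<exists>s. is_lub L s A \<and> s \<notin> \<G>" using s by blast
qed

text \<open>The factors of \<open>\<Or> A\<close> are the elements of \<open>A\<close>: each factor \<open>m\<close> is the join of the elements of
  \<open>A\<close> below it, since otherwise \<open>m\<close> could be replaced by something smaller in the
  factorization. By nestedness this join lies in \<open>\<G>\<close> only if it has a single term.\<close>

lemma nested_antichain_lub:
  assumes N: "nested L \<G> A" and ne: "A \<noteq> {}"
    and anti: "\<And>a b. a \<in> A \<Longrightarrow> b \<in> A \<Longrightarrow> a \<sqsubseteq> b \<Longrightarrow> a = b"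
  obtains s where "is_lub L s A" "\<And>h. h \<in> \<G> \<Longrightarrow> h \<sqsubseteq> s \<Longrightarrow> \<exists>a\<in>A. h \<sqsubseteq> a"
proof -
  have AG: "A \<subseteq> \<G>" using N by (simp add: nested_def)
  then have Ac: "A \<subseteq> carrier L" and fin: "finite A"
    using building_subset finite_building finite_subset by auto
  show thesis
  proof (cases "card A \<ge> 2")
    \<comment> \<open>Nestedness imposes no condition on singletons; the join is then the element
      itself.\<close>
    case False
    then have "card A = 1" using ne fin card_0_eq[of A] by linarith
    then obtain a where "A = {a}" using card_1_singletonE by blast
    then show thesis using that[of a] Ac is_lub_iff[OF Ac, of a] by auto
  next
    case True
    then obtain x where x: "is_lub L x A"
      using N anti unfolding nested_def by (metis order_refl)
    note x' = x[unfolded is_lub_iff[OF Ac]]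
    have xc: "x \<in> carrier L" using x' by blast
    obtain a0 where a0: "a0 \<in> A" using ne by blast
    have xb: "x \<noteq> \<bottom>"
    proof
      assume "x = \<bottom>"
      then have "a0 = \<bottom>" using a0 x' Ac by (intro le_antisym) auto
      then show False using a0 AG bottom_notin_building by blast
    qed
    have mA: "m \<in> A" if m: "m \<in> factors x" for m
    proof -
      have mG: "m \<in> \<G>" and mc: "m \<in> carrier L" using m factors_subset building_subset by blast+
      define B where "B = {a \<in> A. a \<sqsubseteq> m}"
      have B: "B \<subseteq> A" "B \<subseteq> carrier L" using Ac by (auto simp: B_def)
      \<comment> \<open>Replacing \<open>m\<close> by \<open>y\<close> still gives an upper bound
        \<open>u\<close> of all of \<open>A\<close>: elements of \<open>B\<close> are below
        \<open>y\<close>, the others are below other factors. So \<open>x\<close>, and with it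
        \<open>m\<close>, is below \<open>u\<close>, which forces \<open>y = m\<close>.\<close>
      have only: "y = m" if y: "y \<in> carrier L" "y \<sqsubseteq> m" "\<forall>b\<in>B. b \<sqsubseteq> y" for y
      proof -
        obtain u where u: "u \<in> carrier L" "u \<sqsubseteq> x" "y \<sqsubseteq> u" "m \<sqsubseteq> u \<Longrightarrow> y = m"
          "\<And>m'. m' \<in> factors x \<Longrightarrow> m' \<noteq> m \<Longrightarrow> m' \<sqsubseteq> u"
          using replace_factor[OF xc xb m y(1,2)] by blast
        have "a \<sqsubseteq> u" if a: "a \<in> A" for a
        proof (cases "a \<in> B")
          case True
          then show ?thesis using le_trans[of a y u] y u a Ac by auto
        next
          case False
          obtain m' where m': "m' \<in> factors x" "a \<sqsubseteq> m'"
            using factor_above[of a x] a x' AG by blast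
          then have "m' \<noteq> m" "m' \<in> carrier L"
            using False a factor_closed by (auto simp: B_def)
          then show ?thesis using le_trans[of a m' u] m' u a Ac by auto
        qed
        then have "x \<sqsubseteq> u" using x' u by blast
        moreover have "m \<sqsubseteq> x" using m by (simp add: mem_factors)
        ultimately show "y = m" using u mc xc le_trans[of m x u] by blast
      qed
      have "b \<sqsubseteq> m" if "b \<in> B" for b using that by (simp add: B_def)
      then obtain s where s: "is_lub L s B" "s \<sqsubseteq> m" using lub_exists[OF B(2) mc] by blast
      have "s = m" using s unfolding is_lub_iff[OF B(2)] by (intro only) auto
      \<comment> \<open>With two elements or more, nestedness would put the join of
        \<open>B\<close>, which is \<open>m\<close>, outside \<G>.\<close>
      have "card B < 2"
      proof (rule ccontr)
        assume "\<not> card B < 2"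
        then obtain s' where s': "is_lub L s' B" "s' \<notin> \<G>"
          using N B(1) anti unfolding nested_def
          by (metis (no_types, lifting) linorder_not_le subsetD)
        have "s' = s" using s(1) s'(1) unfolding is_lub_iff[OF B(2)] by (intro le_antisym) auto
        then show False using s' \<open>s = m\<close> mG by simp
      qed
      \<comment> \<open>For empty \<open>B\<close>, the bottom would qualify as \<open>y\<close> in
        \<open>only\<close>, making \<open>m\<close> the bottom.\<close>
      moreover have "B \<noteq> {}"
        using only[of \<bottom>] mG mc bottom_notin_building by auto
      moreover have "finite B" using B fin finite_subset by blast
      ultimately have "card B = 1" using card_0_eq[of B] by linarith
      then obtain b where b: "B = {b}" using card_1_singletonE by blast
      then have "b = m" using only[of b] B by (auto simp: B_def)
      then show ?thesis using b B by auto
    qed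
    show thesis
    proof (rule that[OF x])
      fix h assume "h \<in> \<G>" "h \<sqsubseteq> x"
      then show "\<exists>a\<in>A. h \<sqsubseteq> a" using factor_above mA by metis
    qed
  qed
qed

text \<open>Dropping the factors of \<open>y\<close> below \<open>g\<close> leaves a nested
  antichain \<open>A\<close> with the same upper bounds as \<open>{y, g}\<close>. By
  \<open>nested_antichain_lub\<close> each factor of the join is below an element of
  \<open>A\<close>, and equals it by maximality.\<close>

lemma nested_insert_lub:
  assumes y: "y \<in> carrier L" and g: "g \<in> \<G>" "\<not> g \<sqsubseteq> y" and N: "nested L \<G> (insert g (factors y))"
  obtains z where "is_lub L z {y, g}" "factors z \<subseteq> insert g (factors y)"
proof -
  define A where "A = insert g {h \<in> factors y. \<not> h \<sqsubseteq> g}"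
  have gc: "g \<in> carrier L" using g building_subset by blast
  have Ac: "A \<subseteq> carrier L" using gc factors_subset building_subset by (auto simp: A_def)
  note fc = factor_closed[of _ y]
  have gle: "\<not> g \<sqsubseteq> h" if "h \<in> factors y" for h
    using g(2) le_trans[OF _ factor_le[OF that] gc fc[OF that] y] by blast
  have "nested L \<G> A" using N by (rule nested_mono) (auto simp: A_def)
  moreover have "a = b" if "a \<in> A" "b \<in> A" "a \<sqsubseteq> b" for a b
    using that gle factor_le[of b y] factor_maximal[of a y b] factors_subset[of y]
    unfolding A_def by blast
  ultimately obtain z where z: "is_lub L z A" and below: "\<And>h. h \<in> \<G> \<Longrightarrow> h \<sqsubseteq> z \<Longrightarrow> \<exists>a\<in>A. h \<sqsubseteq> a"
    using nested_antichain_lub[of A] by (auto simp: A_def)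
  note z' = z[unfolded is_lub_iff[OF Ac]]
  have upper: "(\<forall>a\<in>A. a \<sqsubseteq> u) \<longleftrightarrow> y \<sqsubseteq> u \<and> g \<sqsubseteq> u" if u: "u \<in> carrier L" for u
  proof
    assume *: "\<forall>a\<in>A. a \<sqsubseteq> u"
    then have "g \<sqsubseteq> u" by (simp add: A_def)
    moreover have "h \<sqsubseteq> u" if "h \<in> factors y" for h
      using * that le_trans[OF _ \<open>g \<sqsubseteq> u\<close> fc[OF that] gc u] unfolding A_def by blast
    ultimately show "y \<sqsubseteq> u \<and> g \<sqsubseteq> u"
      using lub_factors[OF y] u is_lub_iff[of "factors y" L y] fc by blast
  next
    assume "y \<sqsubseteq> u \<and> g \<sqsubseteq> u"
    then show "\<forall>a\<in>A. a \<sqsubseteq> u"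
      using le_trans[OF factor_le _ fc y u] unfolding A_def by blast
  qed
  have "y \<sqsubseteq> z \<and> g \<sqsubseteq> z" using z' upper[of z] by blast
  moreover have "z \<sqsubseteq> u" if "u \<in> carrier L" "y \<sqsubseteq> u" "g \<sqsubseteq> u" for u
    using z' upper[OF that(1)] that by blast
  ultimately have "is_lub L z {y, g}" using z' y gc is_lub_iff[of "{y, g}" L z] by simp
  moreover have "factors z \<subseteq> A"
  proof
    fix m assume m: "m \<in> factors z"
    then obtain a where a: "a \<in> A" "m \<sqsubseteq> a"
      using below[OF _ factor_le[OF m]] factors_subset[of z] by blast
    have "a \<sqsubseteq> z" using z' a(1) by blast
    moreover have "a \<in> \<G>" using a(1) factors_subset[of y] g(1) unfolding A_def by blast
    ultimately have "a = m" using factor_maximal[OF m _ _ a(2)] by simp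
    then show "m \<in> A" using a by simp
  qed
  moreover have "A \<subseteq> insert g (factors y)" by (auto simp: A_def)
  ultimately show thesis using that by blast
qed

text \<open>Only antichains \<open>A\<close> containing \<open>g\<close> are new. The nested
  antichain \<open>B\<close> also contains \<open>g\<close>, and its join \<open>r\<close> bounds
  \<open>A\<close>, as factors of \<open>y\<close> lie below factors of \<open>w\<close>. If the
  join of \<open>A\<close> were in \<G>, it would lie below some \<open>b\<close> in
  \<open>B\<close>; then \<open>g\<close> is below \<open>b\<close>, so \<open>b = g\<close>, and
  \<open>A\<close> collapses to \<open>{g}\<close>.\<close>

lemma nested_insert_factor_above:
  assumes y: "y \<in> carrier L" "nested L \<G> (N \<union> factors y)"
    and w: "w \<in> carrier L" "nested L \<G> (N \<union> factors w)"
    and "y \<sqsubseteq> w" and g: "g \<in> factors w"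
  shows "nested L \<G> (insert g (N \<union> factors y))"
proof -
  have sub: "insert g (N \<union> factors y) \<subseteq> \<G>"
    using y g factors_subset by (auto simp: nested_def)
  have NG: "N \<union> factors w \<subseteq> \<G>" using w by (simp add: nested_def)
  have "\<exists>s. is_lub L s A \<and> s \<notin> \<G>" if A: "A \<subseteq> insert g (N \<union> factors y)" "2 \<le> card A"
    "\<forall>x\<in>A. \<forall>y\<in>A. x \<noteq> y \<longrightarrow> \<not> x \<sqsubseteq> y" for A
  proof (cases "g \<in> A")
    case False
    then have "A \<subseteq> N \<union> factors y" using A by blast
    then show ?thesis using y(2) A unfolding nested_def by blast
  next
    case True
    have Ac: "A \<subseteq> carrier L" using A sub building_subset by blast
    \<comment> \<open>Intersecting \<open>N\<close> with \<open>A\<close> keeps \<open>g\<close>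
      maximal in \<open>C\<close>: elements of \<open>A\<close> are incomparable to
      \<open>g\<close>, and so are the other factors of \<open>w\<close>.\<close>
    define C where "C = (A \<inter> N) \<union> factors w"
    have CG: "C \<subseteq> \<G>" using NG by (auto simp: C_def)
    then have C: "finite C" "C \<subseteq> carrier L"
      using finite_subset[OF CG finite_building] building_subset by auto
    define B where "B = {c \<in> C. \<forall>z\<in>C. c \<sqsubseteq> z \<longrightarrow> z = c}"
    have "nested L \<G> B" using w(2) by (rule nested_mono) (auto simp: B_def C_def)
    moreover have gB: "g \<in> B"
    proof -
      have "z = g" if z: "z \<in> C" "g \<sqsubseteq> z" for z
      proof (cases "z \<in> A")
        case True
        then show ?thesis using A(3) \<open>g \<in> A\<close> z(2) by metis
      next
        case False
        then have "z \<in> factors w" using z(1) by (simp add: C_def)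
        then show ?thesis using factor_maximal[OF g _ factor_le z(2)] factors_subset by blast
      qed
      then show ?thesis using g by (auto simp: B_def C_def)
    qed
    moreover have "a = b" if "a \<in> B" "b \<in> B" "a \<sqsubseteq> b" for a b using that by (auto simp: B_def)
    ultimately obtain r where r: "is_lub L r B" "\<And>h. h \<in> \<G> \<Longrightarrow> h \<sqsubseteq> r \<Longrightarrow> \<exists>b\<in>B. h \<sqsubseteq> b"
      using nested_antichain_lub[of B] by blast
    have Bc: "B \<subseteq> carrier L" using C by (auto simp: B_def)
    note r' = r(1)[unfolded is_lub_iff[OF Bc]]
    have CB: "c \<sqsubseteq> r" if c: "c \<in> C" for c
    proof -
      obtain b where "b \<in> C" "c \<sqsubseteq> b" "\<And>z. z \<in> C \<Longrightarrow> b \<sqsubseteq> z \<Longrightarrow> z = b"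
        using finite_maximal_above[OF C c] by blast
      then have "b \<in> B" "c \<sqsubseteq> b" by (auto simp: B_def)
      then have "b \<in> B" "c \<sqsubseteq> b" "b \<sqsubseteq> r" using r' by auto
      then show ?thesis using le_trans[of c b r] r' c C Bc by blast
    qed
    have "a \<sqsubseteq> r" if a: "a \<in> A" for a
    proof -
      consider "a = g" | "a \<in> N" | "a \<in> factors y" using a A by blast
      then show ?thesis
      proof cases
        case 3
        then have "a \<in> \<G>" "a \<sqsubseteq> w"
          using le_trans[OF factor_le[OF 3] \<open>y \<sqsubseteq> w\<close> factor_closed[OF 3] y(1) w(1)] factors_subset
          by auto
        then obtain m where m: "m \<in> factors w" "a \<sqsubseteq> m" using factor_above by blast
        then have "m \<sqsubseteq> r" by (intro CB) (simp add: C_def)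
        moreover have "a \<in> carrier L" "r \<in> carrier L" using a Ac r' by auto
        ultimately show ?thesis using le_trans[OF m(2)] factor_closed[OF m(1)] by blast
      qed (use a g CB in \<open>auto simp: C_def\<close>)
    qed
    then obtain s where s: "is_lub L s A" "s \<sqsubseteq> r" using lub_exists[OF Ac] r' by blast
    note s' = s(1)[unfolded is_lub_iff[OF Ac]]
    have "s \<notin> \<G>"
    proof
      assume "s \<in> \<G>"
      then obtain b where b: "b \<in> B" "s \<sqsubseteq> b" using r s by blast
      have sb: "s \<in> carrier L" "b \<in> carrier L" "g \<in> carrier L" "g \<sqsubseteq> s" using s' True Ac Bc b(1) by auto
      then have "g \<sqsubseteq> b" using le_trans[OF _ b(2)] by blast
      then have "b = g" using gB b by (auto simp: B_def)
      have "a \<sqsubseteq> g" if "a \<in> A" for a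
      proof -
        have "a \<in> carrier L" "a \<sqsubseteq> s" using s' Ac that by auto
        then show ?thesis using le_trans[OF _ b(2)] sb \<open>b = g\<close> by blast
      qed
      then have "A \<subseteq> {g}" using A(3) True by blast
      then show False using card_ge_2_not_le[OF A(2)] by blast
    qed
    then show ?thesis using s(1) by blast
  qed
  then show ?thesis using sub unfolding nested_def by simp
qed

end

section \<open>Iterated blowups\<close>

text \<open>The element of the \<open>k\<close>-th blowup with base element \<open>y\<close> that was turned into a new symbol
  exactly in the steps in \<open>I\<close>.\<close>

primrec tagged :: "(nat \<Rightarrow> 'a) \<Rightarrow> nat \<Rightarrow> nat set \<Rightarrow> 'a \<Rightarrow> 'a blowup_elem" where
  "tagged G 0 I y = Elem y"
| "tagged G (Suc k) I y =
    (if Suc k \<in> I then New ((Old ^^ k) (Elem (G (Suc k)))) (tagged G k I y)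
     else Old (tagged G k I y))"

lemma tagged_empty: "tagged G k {} y = (Old ^^ k) (Elem y)"
  by (induction k) auto

lemma tagged_cong:
  "(\<And>i. 1 \<le> i \<Longrightarrow> i \<le> k \<Longrightarrow> i \<in> I \<longleftrightarrow> i \<in> J) \<Longrightarrow> tagged G k I y = tagged G k J y"
  by (induction k) auto

text \<open>Stated with one inclusion so as to match the right-hand side of
  \<open>tagged_le_iff\<close> in the case of equal terms.\<close>

lemma tagged_eqD:
  "tagged G k I y = tagged G k J z \<Longrightarrow> I \<inter> {1..k} \<subseteq> J \<and> y = z"
proof (induction k)
  case (Suc k)
  then have "I \<inter> {1..k} \<subseteq> J \<and> y = z" "Suc k \<in> I \<longrightarrow> Suc k \<in> J"
    by (simp_all split: if_splits)
  then show ?case by (auto simp: atLeastAtMostSuc_conv)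
qed auto

section \<open>The order of the iterated blowups in terms of tags\<close>

lemma eq_iterated_blowup: "eq (iterated_blowup L G k) = (=)"
  by (cases k) (auto simp: elem_poset_def blowup_def)

text \<open>Reflexivity of \<open>P\<close> is not assumed, hence the disjuncts
  \<open>u = v\<close>; this allows a use before the iterated blowups are known to be
  posets.\<close>

lemma blowup_le:
  assumes "eq P = (=)"
  shows "Old u \<sqsubseteq>\<^bsub>blowup P \<alpha>\<^esub> Old v \<longleftrightarrow> u = v \<or> u \<sqsubseteq>\<^bsub>P\<^esub> v"
    and "New \<alpha> u \<sqsubseteq>\<^bsub>blowup P \<alpha>\<^esub> New \<alpha> v \<longleftrightarrow> u = v \<or> u \<sqsubseteq>\<^bsub>P\<^esub> v"
    and "Old u \<sqsubseteq>\<^bsub>blowup P \<alpha>\<^esub> New \<alpha> v \<longleftrightarrow> u \<sqsubseteq>\<^bsub>P\<^esub> v"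
    and "\<not> New \<alpha> u \<sqsubseteq>\<^bsub>blowup P \<alpha>\<^esub> Old v"
  using assms by (auto simp: blowup_def blowup_less.simps lless_def)

text \<open>A new symbol may lie above an old element but never below one, so each blowup adds
  exactly the implication between the two tags of that step.\<close>

lemma tagged_le_iff:
  assumes "y \<sqsubseteq>\<^bsub>L\<^esub> y" "z \<sqsubseteq>\<^bsub>L\<^esub> z"
  shows "tagged G k I y \<sqsubseteq>\<^bsub>iterated_blowup L G k\<^esub> tagged G k J z \<longleftrightarrow>
    I \<inter> {1..k} \<subseteq> J \<and> y \<sqsubseteq>\<^bsub>L\<^esub> z"
proof (induction k)
  case 0
  then show ?case by (simp add: elem_poset_def)
next
  case (Suc k)
  have eq: "tagged G k I y = tagged G k J z \<Longrightarrow> I \<inter> {1..k} \<subseteq> J \<and> y \<sqsubseteq>\<^bsub>L\<^esub> z"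
    using tagged_eqD assms(1) by metis
  have "I \<inter> {1..Suc k} \<subseteq> J \<longleftrightarrow> (Suc k \<in> I \<longrightarrow> Suc k \<in> J) \<and> I \<inter> {1..k} \<subseteq> J"
    by (auto simp: atLeastAtMostSuc_conv)
  then show ?case
    using Suc.IH eq by (auto simp: blowup_le[OF eq_iterated_blowup])
qed

section \<open>The elements of the iterated blowups\<close>

context building_semilattice
begin

text \<open>The hypothesis \<open>up\<close> makes every initial segment of the chosen order upward
  closed in \<G>. It is inherited by smaller \<open>k\<close>, as the induction requires.\<close>

lemma carrier_iterated_blowup:
  assumes GG: "G ` {1..k} \<subseteq> \<G>" and inj: "inj_on G {1..k}"
    and up: "\<And>g j. g \<in> \<G> \<Longrightarrow> j \<in> {1..k} \<Longrightarrow> G j \<sqsubseteq> g \<Longrightarrow> g \<in> G ` {1..j}"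
  shows "carrier (iterated_blowup L G k) =
    {tagged G k I y | I y. I \<subseteq> {1..k} \<and> y \<in> carrier L \<and> (\<forall>i\<in>{1..k}. \<not> G i \<sqsubseteq> y) \<and>
      nested L \<G> (G ` I \<union> factors y)}"
  using assms
proof (induction k)
  case 0
  then show ?case using nested_factors by (auto simp: elem_poset_def)
next
  case (Suc k)
  let ?P = "iterated_blowup L G k" and ?g = "G (Suc k)"
  define C where "C = (\<lambda>k. {(I, y). I \<subseteq> {1..k} \<and> y \<in> carrier L \<and> (\<forall>i\<in>{1..k}. \<not> G i \<sqsubseteq> y) \<and>
      nested L \<G> (G ` I \<union> factors y)})"
  have P: "carrier ?P = (\<lambda>(I, y). tagged G k I y) ` C k"
  proof -
    have "G ` {1..k} \<subseteq> \<G>" "inj_on G {1..k}" using Suc.prems(1,2) by (auto simp: inj_on_def)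
    moreover have "g \<in> G ` {1..j}" if "g \<in> \<G>" "j \<in> {1..k}" "G j \<sqsubseteq> g" for g j
      using Suc.prems(3)[of g j] that by simp
    ultimately have "carrier ?P = {tagged G k I y | I y. I \<subseteq> {1..k} \<and> y \<in> carrier L \<and>
        (\<forall>i\<in>{1..k}. \<not> G i \<sqsubseteq> y) \<and> nested L \<G> (G ` I \<union> factors y)}"
      by (rule Suc.IH)
    then show ?thesis by (auto simp: C_def)
  qed
  have "?g \<in> \<G>" using Suc.prems(1) by auto
  then have g: "?g \<in> \<G>" "?g \<in> carrier L" using building_subset by blast+
  \<comment> \<open>By \<open>up\<close>, everything in \<G> above \<open>G i\<close> has index at
    most \<open>i\<close>; so the next centre survives the first \<open>k\<close> blowups.\<close>
  have not_le_g: "\<not> G i \<sqsubseteq> ?g" if "i \<in> {1..k}" for i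
  proof
    assume "G i \<sqsubseteq> ?g"
    then have "?g \<in> G ` {1..i}" using Suc.prems(3)[of ?g i] that g by auto
    then obtain j where "j \<in> {1..i}" "?g = G j" by blast
    then show False using inj_onD[OF Suc.prems(2), of "Suc k" j] that by auto
  qed
  have g_C: "({}, ?g) \<in> C k"
    using g not_le_g nested_factors[of ?g] by (auto simp: C_def)
  have le: "tagged G k I y \<sqsubseteq>\<^bsub>?P\<^esub> tagged G k J z \<longleftrightarrow> I \<subseteq> J \<and> y \<sqsubseteq> z"
    if "(I, y) \<in> C k" "(J, z) \<in> C k" for I y J z
  proof -
    have "I \<inter> {1..k} = I" "y \<sqsubseteq> y" "z \<sqsubseteq> z" using that by (auto simp: C_def)
    then show ?thesis using tagged_le_iff[of L y z G k I J] by simp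
  qed
  \<comment> \<open>This translates the existence of the join with the centre, which decides whether
    a new symbol is formed, into nestedness.\<close>
  have lub_iff: "(\<exists>s. is_lub ?P s {tagged G k I y, tagged G k {} ?g}) \<longleftrightarrow>
      nested L \<G> (insert ?g (G ` I \<union> factors y))"
    if C: "(I, y) \<in> C k" and gy: "\<not> ?g \<sqsubseteq> y" for I y
  proof
    have sub: "{tagged G k I y, tagged G k {} ?g} \<subseteq> carrier ?P"
      unfolding P using C g_C by force
    note lub = is_lub_iff[OF sub]
    have y: "y \<in> carrier L" "nested L \<G> (G ` I \<union> factors y)" using C by (auto simp: C_def)
    {
      assume "\<exists>s. is_lub ?P s {tagged G k I y, tagged G k {} ?g}"
      then obtain s where s: "s \<in> carrier ?P"
        "tagged G k I y \<sqsubseteq>\<^bsub>?P\<^esub> s" "tagged G k {} ?g \<sqsubseteq>\<^bsub>?P\<^esub> s"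
        unfolding lub by blast
      then obtain J w where Jw: "(J, w) \<in> C k" "s = tagged G k J w" unfolding P by auto
      then have le': "I \<subseteq> J" "y \<sqsubseteq> w" "?g \<sqsubseteq> w" using s le C g_C by auto
      have w: "w \<in> carrier L" "nested L \<G> (G ` J \<union> factors w)" "\<forall>i\<in>{1..k}. \<not> G i \<sqsubseteq> w"
        using Jw by (auto simp: C_def)
      \<comment> \<open>This \<open>m\<close> is the centre itself: by \<open>up\<close> its index
        is at most \<open>k + 1\<close>, and none of the first \<open>k\<close> elements is below
        \<open>w\<close>.\<close>
      obtain m where m: "m \<in> factors w" "?g \<sqsubseteq> m" using factor_above[OF g(1) le'(3)] by blast
      have "m \<in> G ` {1..Suc k}" using Suc.prems(3)[of m "Suc k"] m factors_subset by auto
      moreover have "m \<notin> G ` {1..k}" using w(3) factor_le[OF m(1)] by blast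
      ultimately have "m = ?g" by (auto simp: atLeastAtMostSuc_conv)
      then have gw: "?g \<in> factors w" using m by simp
      have "nested L \<G> (G ` I \<union> factors w)" using w(2) by (rule nested_mono) (use le' in auto)
      then show "nested L \<G> (insert ?g (G ` I \<union> factors y))"
        using nested_insert_factor_above[OF y w(1)] le'(2) gw by blast
    }
    {
      assume N: "nested L \<G> (insert ?g (G ` I \<union> factors y))"
      then have "nested L \<G> (insert ?g (factors y))" by (rule nested_mono) auto
      then obtain z where z: "is_lub L z {y, ?g}" and fz: "factors z \<subseteq> insert ?g (factors y)"
        using nested_insert_lub[OF y(1) g(1) gy] by blast
      have z': "z \<in> carrier L" "y \<sqsubseteq> z" "?g \<sqsubseteq> z"
        "\<And>u. u \<in> carrier L \<Longrightarrow> y \<sqsubseteq> u \<Longrightarrow> ?g \<sqsubseteq> u \<Longrightarrow> z \<sqsubseteq> u"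
        using z is_lub_iff[of "{y, ?g}" L z] y g by auto
      \<comment> \<open>The pair \<open>(I, z)\<close> is to be the join, with the tags unchanged.
        An earlier \<open>G i\<close> below \<open>z\<close> would lie below a factor of
        \<open>z\<close>, hence below the centre or below \<open>y\<close>.\<close>
      have "\<not> G i \<sqsubseteq> z" if i: "i \<in> {1..k}" for i
      proof
        assume "G i \<sqsubseteq> z"
        moreover have Gi: "G i \<in> \<G>" using Suc.prems(1) i by auto
        ultimately obtain m where m: "m \<in> factors z" "G i \<sqsubseteq> m" using factor_above by blast
        then have "m = ?g \<or> m \<in> factors y" using fz by blast
        then have "G i \<sqsubseteq> ?g \<or> G i \<sqsubseteq> y"
          using m Gi y(1) building_subset factor_closed factor_le le_trans[of "G i" m y] by blast
        then show False using not_le_g[OF i] C i by (auto simp: C_def)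
      qed
      moreover have "nested L \<G> (G ` I \<union> factors z)"
        using N by (rule nested_mono) (use fz in auto)
      ultimately have Cz: "(I, z) \<in> C k" using C z' by (auto simp: C_def)
      have "tagged G k I z \<sqsubseteq>\<^bsub>?P\<^esub> u" if u: "u \<in> carrier ?P"
        "tagged G k I y \<sqsubseteq>\<^bsub>?P\<^esub> u" "tagged G k {} ?g \<sqsubseteq>\<^bsub>?P\<^esub> u" for u
      proof -
        obtain J w where Jw: "(J, w) \<in> C k" "u = tagged G k J w" using u(1) unfolding P by auto
        then show ?thesis using u(2,3) le C g_C Cz z'(4)[of w] by (auto simp: C_def)
      qed
      moreover have "tagged G k I z \<in> carrier ?P" unfolding P using Cz by force
      ultimately have "is_lub ?P (tagged G k I z) {tagged G k I y, tagged G k {} ?g}"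
        unfolding lub using le C Cz g_C z' by auto
      then show "\<exists>s. is_lub ?P s {tagged G k I y, tagged G k {} ?g}" by blast
    }
  qed
  \<comment> \<open>Splitting by whether \<open>Suc k\<close> is a tag matches the two kinds of
    blowup elements; the second part carries the condition from \<open>lub_iff\<close>.\<close>
  have C_Suc: "C (Suc k) = {(I, y). (I, y) \<in> C k \<and> \<not> ?g \<sqsubseteq> y} \<union>
     {(insert (Suc k) I, y) | I y. (I, y) \<in> C k \<and> \<not> ?g \<sqsubseteq> y \<and>
        nested L \<G> (insert ?g (G ` I \<union> factors y))}" (is "_ = ?R")
  proof (intro equalityI subsetI)
    fix p assume "p \<in> C (Suc k)"
    then obtain I y where p: "p = (I, y)" "I \<subseteq> {1..Suc k}" "y \<in> carrier L"
      "\<forall>i\<in>{1..Suc k}. \<not> G i \<sqsubseteq> y" and N: "nested L \<G> (G ` I \<union> factors y)"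
      by (auto simp: C_def)
    show "p \<in> ?R"
    proof (cases "Suc k \<in> I")
      case False
      then have "I \<subseteq> {1..k}" using p(2) by (auto simp: atLeastAtMostSuc_conv)
      then show ?thesis using p N by (auto simp: C_def)
    next
      case True
      define J where "J = I - {Suc k}"
      have I: "I = insert (Suc k) J" and J: "J \<subseteq> {1..k}"
        using True p(2) by (auto simp: J_def atLeastAtMostSuc_conv)
      have "nested L \<G> (G ` J \<union> factors y)" using N by (rule nested_mono) (auto simp: I)
      then have "(J, y) \<in> C k" using p J by (auto simp: C_def)
      moreover have "nested L \<G> (insert ?g (G ` J \<union> factors y))" using N by (simp add: I)
      ultimately show ?thesis using p I by auto
    qed
  qed (auto simp: C_def atLeastAtMostSuc_conv)
  let ?\<alpha> = "(Old ^^ k) (Elem ?g)"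
  have \<alpha>: "?\<alpha> = tagged G k {} ?g" by (simp add: tagged_empty)
  have Old: "{Old u | u. u \<in> carrier ?P \<and> \<not> ?\<alpha> \<sqsubseteq>\<^bsub>?P\<^esub> u} =
      {tagged G (Suc k) I y | I y. (I, y) \<in> C k \<and> \<not> ?g \<sqsubseteq> y}" (is "?A = ?B")
  proof -
    have "Suc k \<notin> I" if "(I, y) \<in> C k" for I y using that by (auto simp: C_def)
    then have "?B = {Old (tagged G k I y) | I y. (I, y) \<in> C k \<and> \<not> ?g \<sqsubseteq> y}"
      by (intro Collect_cong) (metis tagged.simps(2))
    also have "\<dots> = ?A" unfolding P \<alpha> using le[OF g_C] by fastforce
    finally show ?thesis by simp
  qed
  have New: "{New ?\<alpha> u | u. u \<in> carrier ?P \<and> \<not> ?\<alpha> \<sqsubseteq>\<^bsub>?P\<^esub> u \<and> (\<exists>s. is_lub ?P s {u, ?\<alpha>})} =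
      {tagged G (Suc k) (insert (Suc k) I) y | I y. (I, y) \<in> C k \<and> \<not> ?g \<sqsubseteq> y \<and>
        nested L \<G> (insert ?g (G ` I \<union> factors y))}" (is "?A = ?B")
  proof -
    have "tagged G (Suc k) (insert (Suc k) I) y = New ?\<alpha> (tagged G k I y)" for I y
      using tagged_cong[of k "insert (Suc k) I" I] by simp
    then have "?B = {New ?\<alpha> (tagged G k I y) | I y. (I, y) \<in> C k \<and> \<not> ?g \<sqsubseteq> y \<and>
        nested L \<G> (insert ?g (G ` I \<union> factors y))}" by simp
    also have "\<dots> = {New ?\<alpha> (tagged G k I y) | I y. (I, y) \<in> C k \<and> \<not> ?g \<sqsubseteq> y \<and>
        (\<exists>s. is_lub ?P s {tagged G k I y, tagged G k {} ?g})}"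
      using lub_iff by blast
    also have "\<dots> = ?A" unfolding P \<alpha> using le[OF g_C] by fastforce
    finally show ?thesis by simp
  qed
  have "carrier (iterated_blowup L G (Suc k)) =
      {tagged G (Suc k) I y | I y. (I, y) \<in> C (Suc k)}"
    unfolding C_Suc iterated_blowup.simps blowup_def partial_object.simps Old New by blast
  then show ?case by (simp add: C_def)
qed

end

section \<open>The final blowup\<close>

text \<open>The isomorphism is constructed from nested sets to the final blowup; this turns it
  around.\<close>

lemma poset_iso_inverse:
  assumes "poset_iso P Q f"
  shows "poset_iso Q P (the_inv_into (carrier P) f)"
proof -
  let ?g = "the_inv_into (carrier P) f"
  have bij: "bij_betw f (carrier P) (carrier Q)" and emb: "order_emb P Q f"
    using assms by (auto simp: poset_iso_def)
  have g: "?g y \<in> carrier P" "f (?g y) = y" if "y \<in> carrier Q" for y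
    using bij that by (auto simp: bij_betw_def the_inv_into_into f_the_inv_into_f)
  have "?g x \<sqsubseteq>\<^bsub>P\<^esub> ?g y \<longleftrightarrow> x \<sqsubseteq>\<^bsub>Q\<^esub> y" if "x \<in> carrier Q" "y \<in> carrier Q" for x y
    using emb g[OF that(1)] g[OF that(2)] unfolding order_emb_def by metis
  then show ?thesis
    using bij_betw_the_inv_into[OF bij] emb by (auto simp: poset_iso_def order_emb_def)
qed

theorem theorem3p4:
  fixes L :: "'a gorder" and \<G> :: "'a set" and G :: "nat \<Rightarrow> 'a" and t :: nat
  assumes "lower_semilattice L" and "finite (carrier L)" and "carrier L \<noteq> {}"
    and "building_set L \<G>"
    and "bij_betw G {1..t} \<G>"
    and "\<forall>i\<in>{1..t}. \<forall>j\<in>{1..t}. G j \<sqsubset>\<^bsub>L\<^esub> G i \<longrightarrow> i < j"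
  shows "\<exists>f. poset_iso (iterated_blowup L G t) (face_poset (nested_complex L \<G>)) f"
proof -
  interpret building_semilattice L \<G>
    using assms(1-4) by (intro building_semilattice.intro building_semilattice_axioms.intro)
  have GG: "G ` {1..t} = \<G>" and inj: "inj_on G {1..t}" using assms(5) by (auto simp: bij_betw_def)
  let ?B = "iterated_blowup L G t" and ?F = "face_poset (nested_complex L \<G>)"
  define idx where "idx = (\<lambda>N. {i \<in> {1..t}. G i \<in> N})"
  \<comment> \<open>In the final blowup only the base \<open>\<bottom>\<close> remains, so an
    element is determined by its tags, which are the indices of a nested set.\<close>
  define f where "f = (\<lambda>N. tagged G t (idx N) \<bottom>\<^bsub>L\<^esub>)"
  have G_idx: "G ` idx N = N" if "N \<subseteq> \<G>" for N using that GG by (auto simp: idx_def)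
  \<comment> \<open>This derives \<open>up\<close> from the linear order: for
    \<open>g = G i\<close>, equality with \<open>G j\<close> gives \<open>i = j\<close> by
    injectivity, and strict comparability gives \<open>i < j\<close>.\<close>
  have "g \<in> G ` {1..j}" if g: "g \<in> \<G>" and j: "j \<in> {1..t}" "G j \<sqsubseteq>\<^bsub>L\<^esub> g" for g j
  proof -
    obtain i where i: "i \<in> {1..t}" "g = G i" using g GG by blast
    have "i \<le> j"
    proof (cases "G j = G i")
      case True
      then show ?thesis using inj_onD[OF inj True j(1) i(1)] by simp
    next
      case False
      then have "G j \<sqsubset>\<^bsub>L\<^esub> G i" using i j by (simp add: lless_def eq_is_equal)
      then show ?thesis using assms(6) i(1) j(1) less_imp_le by blast
    qed
    then show ?thesis using i by auto
  qed
  from carrier_iterated_blowup[OF _ inj this]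
  have carrier_B: "carrier ?B = {tagged G t I y | I y. I \<subseteq> {1..t} \<and> y \<in> carrier L \<and>
      (\<forall>i\<in>{1..t}. \<not> G i \<sqsubseteq>\<^bsub>L\<^esub> y) \<and> nested L \<G> (G ` I \<union> factors y)}"
    using GG by simp
  have carrier_F: "carrier ?F = {N. nested L \<G> N}" and le_F: "M \<sqsubseteq>\<^bsub>?F\<^esub> N \<longleftrightarrow> M \<subseteq> N"
    and eq_F: "eq ?F = (=)" for M N
    by (auto simp: face_poset_def nested_complex_def)
  have image: "f ` carrier ?F = carrier ?B"
  proof (intro equalityI subsetI)
    fix u assume "u \<in> f ` carrier ?F"
    then obtain N where N: "nested L \<G> N" "u = f N" by (auto simp: carrier_F)
    then have "G ` idx N = N" using G_idx by (simp add: nested_def)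
    moreover have "\<not> G i \<sqsubseteq>\<^bsub>L\<^esub> \<bottom>\<^bsub>L\<^esub>" if "i \<in> {1..t}" for i
    proof
      assume "G i \<sqsubseteq>\<^bsub>L\<^esub> \<bottom>\<^bsub>L\<^esub>"
      moreover have "G i \<in> \<G>" using GG that by blast
      ultimately show False using factor_above factors_bottom by blast
    qed
    moreover have "idx N \<subseteq> {1..t}" by (auto simp: idx_def)
    ultimately show "u \<in> carrier ?B" using N unfolding carrier_B f_def
      by (intro CollectI exI[of _ "idx N"] exI[of _ "\<bottom>\<^bsub>L\<^esub>"]) (auto simp: factors_bottom)
  next
    fix u assume "u \<in> carrier ?B"
    then obtain I y where u: "u = tagged G t I y" "I \<subseteq> {1..t}" "y \<in> carrier L"
      "\<forall>i\<in>{1..t}. \<not> G i \<sqsubseteq>\<^bsub>L\<^esub> y" "nested L \<G> (G ` I \<union> factors y)"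
      unfolding carrier_B by blast
    \<comment> \<open>All of \<G> has been blown up, so no element of \<G> is below
      \<open>y\<close>.\<close>
    have "factors y = {}" using u(4) GG factor_le[of _ y] factors_subset[of y] by blast
    then have y: "y = \<bottom>\<^bsub>L\<^esub>" using factors_eq_empty u(3) by blast
    have "idx (G ` I) = I" using u(2) inj by (auto simp: idx_def dest: inj_onD)
    then have "u = f (G ` I)" using u(1) y by (simp add: f_def)
    moreover have "nested L \<G> (G ` I)" using u(5) by (rule nested_mono) simp
    ultimately show "u \<in> f ` carrier ?F" by (simp add: carrier_F)
  qed
  have le_f: "f M \<sqsubseteq>\<^bsub>?B\<^esub> f N \<longleftrightarrow> M \<subseteq> N" if "M \<in> carrier ?F" "N \<in> carrier ?F" for M N
  proof -
    have "M \<subseteq> \<G>" "N \<subseteq> \<G>" using that by (auto simp: carrier_F nested_def)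
    then have "idx M \<subseteq> idx N \<longleftrightarrow> M \<subseteq> N"
      using G_idx image_mono[of "idx M" "idx N" G] by (auto simp: idx_def)
    moreover have "idx M \<inter> {1..t} = idx M" by (auto simp: idx_def)
    ultimately show ?thesis
      unfolding f_def using tagged_le_iff[of L "\<bottom>\<^bsub>L\<^esub>" "\<bottom>\<^bsub>L\<^esub>" G t "idx M" "idx N"] by simp
  qed
  have "inj_on f (carrier ?F)"
    using le_f by (intro inj_onI) (metis order_refl subset_antisym)
  moreover have "weak_partial_order ?F"
    by unfold_locales (auto simp: le_F eq_F)
  \<comment> \<open>The carrier is the image of \<open>f\<close>, so \<open>le_f\<close> transports
    the order axioms from set inclusion.\<close>
  moreover have "weak_partial_order ?B"
    unfolding weak_partial_order_def equivalence_def weak_partial_order_axioms_def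
      eq_iterated_blowup image[symmetric]
    using le_f by auto
  ultimately have "poset_iso ?F ?B f"
    using image le_f by (auto simp: poset_iso_def order_emb_def bij_betw_def le_F)
  then show ?thesis using poset_iso_inverse by blast
qed

end
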